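(* Let $K\subset\mathbb{R}^d$ be an acute convex body. Then there exists a closed classical billiard trajectory in $K$ with no more than $d+1$ bounces.
   Context: A convex body is a compact convex set with nonempty interior; lengths and angles are Euclidean. For $q\in\partial K$, the cone of outer normals is $N_K(q)=\{n\in\mathbb{R}^d:\langle n,q'-q\rangle\le 0\ \forall q'\in K\}$, and the tangent cone is its polar $T_K(q)=N_K(q)^\circ=\{v:\langle n,v\rangle\le 0\ \forall n\in N_K(q)\}$; both have apex at the origin. A point $q\in\partial K$ is smooth if $N_K(q)$ is a single ray (i.e. the support hyperplane at $q$ is unique), and non-smooth otherwise. Closed generalized billiard trajectory in $K$ with $m\ge 2$ bounces: a closed polygonal line $q_1\to q_2\to\dots\to q_m\to q_1$ with $q_i\in\partial K$ (cyclic indexing) such that for every $i$ the point $q_i$ does not belong to the segment $[q_{i-1},q_{i+1}]$ and the bisector of the angle $\angle q_{i-1}q_iq_{i+1}$ is orthogonal to some support hyperplane of $K$ at $q_i$; equivalently, $\frac{q_i-q_{i-1}}{|q_i-q_{i-1}|}-\frac{q_{i+1}-q_i}{|q_{i+1}-q_i|}$ is a nonzero element of $N_K(q_i)$. The trajectory is classical if all its bounce points $q_i$ are smooth points of $\partial K$. A non-smooth point $q\in\partial K$ satisfies the acuteness condition if the tangent cone can be represented as an orthogonal product $T_K(q)=F\times T^k$, where $T^k$ is a $k$-dimensional cone such that for all points $a,b\in T^k$ different from the apex the angle at the apex between the directions of $a$ and $b$ is strictly less than $\pi/2$, and $F$ is a $(d-k)$-dimensional linear subspace orthogonal to $T^k$.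 The convex body $K$ is acute if all non-smooth points of $\partial K$ satisfy the acuteness condition. *)

theory Defs
  imports "HOL-Analysis.Analysis"
begin

definition convex_body :: "'a::euclidean_space set \<Rightarrow> bool" where
  "convex_body K \<longleftrightarrow> compact K \<and> convex K \<and> interior K \<noteq> {}"

definition normal_cone :: "'a::euclidean_space set \<Rightarrow> 'a \<Rightarrow> 'a set" where
  "normal_cone K q = {n. \<forall>q'\<in>K. n \<bullet> (q' - q) \<le> 0}"

definition polar_cone :: "'a::euclidean_space set \<Rightarrow> 'a set" where
  "polar_cone N = {v. \<forall>n\<in>N. n \<bullet> v \<le> 0}"

definition tangent_cone :: "'a::euclidean_space set \<Rightarrow> 'a \<Rightarrow> 'a set" where
  "tangent_cone K q = polar_cone (normal_cone K q)"

definition smooth_point :: "'a::euclidean_space set \<Rightarrow> 'a \<Rightarrow> bool" where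
  "smooth_point K q \<longleftrightarrow>
     q \<in> frontier K \<and> (\<exists>n. n \<noteq> 0 \<and> normal_cone K q = {t *\<^sub>R n | t. t \<ge> 0})"

text \<open>Angle between two directions; only meaningful for nonzero arguments.\<close>

definition angle_between :: "'a::euclidean_space \<Rightarrow> 'a \<Rightarrow> real" where
  "angle_between a b = arccos ((a \<bullet> b) / (norm a * norm b))"

text \<open>The orthogonal product \<open>F \<times> T\<close> is the sum of the two mutually orthogonal
  sets inside the ambient space. The library predicate \<open>cone\<close> (apex at the origin) also
  admits the empty set, but here \<open>T\<close> is nonempty because the tangent cone contains \<open>0\<close>.
  The angle condition includes the case \<open>a = b\<close>, where it holds trivially.\<close>

definition acuteness_condition :: "'a::euclidean_space set \<Rightarrow> 'a \<Rightarrow> bool" where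
  "acuteness_condition K q \<longleftrightarrow>
     (\<exists>F T k. k \<le> DIM('a) \<and>
        subspace F \<and> dim F = DIM('a) - k \<and>
        cone T \<and> dim T = k \<and>
        (\<forall>f\<in>F. \<forall>t\<in>T. orthogonal f t) \<and>
        tangent_cone K q = {f + t | f t. f \<in> F \<and> t \<in> T} \<and>
        (\<forall>a\<in>T - {0}. \<forall>b\<in>T - {0}. angle_between a b < pi / 2))"

definition acute_body :: "'a::euclidean_space set \<Rightarrow> bool" where
  "acute_body K \<longleftrightarrow>
     (\<forall>q\<in>frontier K. \<not> smooth_point K q \<longrightarrow> acuteness_condition K q)"

text \<open>The bounce points are \<open>q 0, \<dots>, q (m - 1)\<close>, with indices read modulo \<open>m\<close>; other values
  of \<open>q\<close> are irrelevant. With unit vectors \<open>u\<close>, \<open>v\<close> from the bounce point towards its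
  predecessor and successor, the bisector of the angle has direction \<open>u + v\<close>, and the vector
  required to be a nonzero outer normal below is \<open>- (u + v)\<close>. The segment condition excludes
  coinciding consecutive points, so \<open>sgn\<close> is only applied to nonzero vectors.\<close>

definition closed_generalized_billiard_trajectory ::
    "'a::euclidean_space set \<Rightarrow> nat \<Rightarrow> (nat \<Rightarrow> 'a) \<Rightarrow> bool" where
  "closed_generalized_billiard_trajectory K m q \<longleftrightarrow>
     m \<ge> 2 \<and>
     (\<forall>i<m. let p = q ((i + m - 1) mod m); x = q i; s = q ((i + 1) mod m) in
        x \<in> frontier K \<and>
        x \<notin> closed_segment p s \<and>
        sgn (x - p) - sgn (s - x) \<in> normal_cone K x - {0})"

definition closed_classical_billiard_trajectory ::
    "'a::euclidean_space set \<Rightarrow> nat \<Rightarrow> (nat \<Rightarrow> 'a) \<Rightarrow> bool" where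
  "closed_classical_billiard_trajectory K m q \<longleftrightarrow>
     closed_generalized_billiard_trajectory K m q \<and> (\<forall>i<m. smooth_point K (q i))"

end

theory Submission
  imports Defs
begin

text \<open>
  The trajectory is a shortest polygon among all closed polygons, with any number of vertices,
  that no translation moves into the interior of \<open>K\<close>. By Helly's theorem at most \<open>d + 1\<close> vertices
  of such a polygon already prevent every translation, and dropping the other vertices does not
  lengthen it. So the infimum of the perimeter may be taken over the compact set of polygons
  with \<open>d + 1\<close> vertices and a bound on the perimeter, where it is attained. Among the shortest
  polygons, one with the fewest vertices is chosen (\<open>optimal_polygon\<close>). Shrinking it slightly
  makes it fit into the interior, so in the limit some translate of it lies in \<open>K\<close>.

  A polygon in \<open>K\<close> admits no translation into the interior exactly when there are outer normals
  at its vertices, not all zero, with sum zero. Fix such normals \<open>n\<^sub>i\<close> at the vertices \<open>q\<^sub>i\<close> of the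
  optimal polygon. Every polygon with one vertex in each of the
  half-spaces \<open>{z. n\<^sub>i \<bullet> (z - q\<^sub>i) \<ge> 0}\<close> again admits no translation into the interior, so it is at least as
  long. Having the fewest vertices forces \<open>n\<^sub>i \<noteq> 0\<close>, and moving one vertex at a time yields
  the reflection law: with unit vectors \<open>u\<close>, \<open>v\<close> from \<open>q\<^sub>i\<close> towards its neighbours, \<open>- (u + v)\<close> is
  a positive multiple of \<open>n\<^sub>i\<close>.

  Suppose a vertex \<open>q\<close> is non-smooth. The comparison of lengths still holds if \<open>q\<close> is
  counted as two vertices and its normal is replaced by two outer normals \<open>a\<close>, \<open>b\<close> at \<open>q\<close> with that
  sum, because the number of vertices was unrestricted. The tangent cone at \<open>q\<close>
  is narrow, so the normal cone is wide enough to contain such \<open>a\<close>, \<open>b\<close> with \<open>a \<bullet> b < 0\<close>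
  (\<open>acute_cone_wide_polar\<close>). For an obtuse pair, a trajectory that first touches one
  of the two half-spaces and then the other is, for one of the two orders, shorter to first order
  than the trajectory through \<open>q\<close> (\<open>obtuse_splitting_directions\<close>). This contradicts
  minimality, so all vertices are smooth.
\<close>

section \<open>Closed polygons as lists of vertices\<close>

fun path_length :: "'a::metric_space list \<Rightarrow> real" where
  "path_length (x # y # zs) = dist x y + path_length (y # zs)"
| "path_length _ = 0"

definition perimeter :: "'a::metric_space list \<Rightarrow> real" where
  "perimeter xs = path_length xs + dist (last xs) (hd xs)"

lemma path_length_Cons: "ys \<noteq> [] \<Longrightarrow> path_length (x # ys) = dist x (hd ys) + path_length ys"
  by (cases ys) auto

lemma path_length_snoc: "xs \<noteq> [] \<Longrightarrow> path_length (xs @ [y]) = path_length xs + dist (last xs) y"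
  by (induction xs rule: path_length.induct) auto

lemma perimeter_Cons:
  "ys \<noteq> [] \<Longrightarrow> perimeter (x # ys) = dist x (hd ys) + path_length ys + dist (last ys) x"
  by (simp add: perimeter_def path_length_Cons)

lemma perimeter_rotate1: "perimeter (rotate1 xs) = perimeter xs"
proof (cases xs)
  case (Cons x ys)
  then show ?thesis
    by (cases "ys = []")
      (simp_all add: perimeter_def path_length_Cons path_length_snoc dist_commute)
qed simp

lemma perimeter_rotate: "perimeter (rotate n xs) = perimeter xs"
  by (induction n) (simp_all add: perimeter_rotate1)

lemma perimeter_tl_le: "ys \<noteq> [] \<Longrightarrow> perimeter ys \<le> perimeter (x # ys)"
  using dist_triangle[of "last ys" "hd ys" x] by (simp add: perimeter_Cons) (simp add: perimeter_def)

lemma path_length_nonneg: "0 \<le> path_length xs"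
  by (induction xs rule: path_length.induct) auto

lemma dist_hd_le_path_length: "y \<in> set xs \<Longrightarrow> dist (hd xs) y \<le> path_length xs"
proof (induction xs rule: path_length.induct)
  case (1 x z zs)
  show ?case
  proof (cases "y = x")
    case True
    then show ?thesis using path_length_nonneg[of "x # z # zs"] by simp
  next
    case False
    then have "dist z y \<le> path_length (z # zs)" using 1 by simp
    then show ?thesis using dist_triangle[of x y z] by simp
  qed
qed auto

lemma dist_hd_le_perimeter: "y \<in> set xs \<Longrightarrow> dist (hd xs) y \<le> perimeter xs"
  using dist_hd_le_path_length[of y xs] by (simp add: perimeter_def add_increasing2)

lemma path_length_affine:
  fixes xs :: "'a::real_normed_vector list"
  shows "path_length (map (\<lambda>x. c *\<^sub>R x + t) xs) = \<bar>c\<bar> * path_length xs"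
proof (induction xs rule: path_length.induct)
  case (1 x y zs)
  have "dist (c *\<^sub>R x + t) (c *\<^sub>R y + t) = \<bar>c\<bar> * dist x y"
    by (simp add: dist_norm flip: scaleR_diff_right)
  with 1 show ?case by (simp add: algebra_simps)
qed auto

lemma perimeter_affine:
  fixes xs :: "'a::real_normed_vector list"
  assumes "xs \<noteq> []"
  shows "perimeter (map (\<lambda>x. c *\<^sub>R x + t) xs) = \<bar>c\<bar> * perimeter xs"
proof -
  have "dist (c *\<^sub>R x + t) (c *\<^sub>R y + t) = \<bar>c\<bar> * dist x y" for x y :: 'a
    by (simp add: dist_norm flip: scaleR_diff_right)
  with assms show ?thesis
    by (simp add: perimeter_def path_length_affine last_map list.map_sel distrib_left)
qed

lemma perimeter_replicate:
  "perimeter (replicate n x @ x # ys) = perimeter (x # ys)"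
proof (induction n)
  case (Suc n)
  have "hd (replicate n x @ x # ys) = x" by (cases n) auto
  then have "perimeter (replicate (Suc n) x @ x # ys) = perimeter (replicate n x @ x # ys)"
    by (simp add: perimeter_def path_length_Cons)
  with Suc show ?case by simp
qed simp

section \<open>Polygons that do not fit into the interior\<close>

definition untranslatable :: "'a::euclidean_space set \<Rightarrow> 'a set \<Rightarrow> bool" where
  "untranslatable K X \<longleftrightarrow> \<not> (\<exists>t. \<forall>x\<in>X. x + t \<in> interior K)"

lemma untranslatable_mono: "untranslatable K X \<Longrightarrow> X \<subseteq> Y \<Longrightarrow> untranslatable K Y"
  unfolding untranslatable_def by blast

lemma untranslatable_translation:
  "untranslatable K ((\<lambda>x. x + t) ` X) \<longleftrightarrow> untranslatable K X"
proof -
  have "(\<exists>s. \<forall>x\<in>X. x + t + s \<in> interior K) \<longleftrightarrow> (\<exists>s. \<forall>x\<in>X. x + s \<in> interior K)"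
  proof
    assume "\<exists>s. \<forall>x\<in>X. x + t + s \<in> interior K"
    then show "\<exists>s. \<forall>x\<in>X. x + s \<in> interior K" by (auto simp: add.assoc)
  next
    assume "\<exists>s. \<forall>x\<in>X. x + s \<in> interior K"
    then obtain s where "\<forall>x\<in>X. x + s \<in> interior K" by blast
    then have "\<forall>x\<in>X. x + t + (s - t) \<in> interior K" by simp
    then show "\<exists>s. \<forall>x\<in>X. x + t + s \<in> interior K" by blast
  qed
  then show ?thesis by (simp add: untranslatable_def)
qed

lemma untranslatable_nonempty: "untranslatable K X \<Longrightarrow> X \<noteq> {}"
  by (auto simp: untranslatable_def)

text \<open>A translation that moves \<open>X\<close> into the convex set \<open>interior K\<close> moves the whole hull of \<open>X\<close> there.\<close>

lemma untranslatable_remove_hull_point: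
  assumes "convex K" "untranslatable K (insert x X)" "x \<in> convex hull X"
  shows "untranslatable K X"
  unfolding untranslatable_def
proof
  assume "\<exists>t. \<forall>y\<in>X. y + t \<in> interior K"
  then obtain t where t: "\<forall>y\<in>X. y + t \<in> interior K" by blast
  have "convex hull X \<subseteq> (\<lambda>k. k - t) ` interior K"
  proof (rule hull_minimal)
    show "X \<subseteq> (\<lambda>k. k - t) ` interior K"
    proof
      fix y assume "y \<in> X"
      then show "y \<in> (\<lambda>k. k - t) ` interior K"
        using t by (intro image_eqI[of _ _ "y + t"]) auto
    qed
    show "convex ((\<lambda>k. k - t) ` interior K)"
      using assms(1) by (intro convex_translation_subtract convex_interior)
  qed
  then have "x + t \<in> interior K" using assms(3) by auto
  then show False using t assms(2) by (auto simp: untranslatable_def)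
qed

text \<open>The translations that move \<open>x\<close> into the interior form the convex set \<open>interior K - x\<close>, and \<open>X\<close> is
untranslatable iff these sets have no common point.\<close>

lemma untranslatable_helly:
  fixes K :: "'a::euclidean_space set"
  assumes "convex K" "finite X" "untranslatable K X"
  obtains Y where "Y \<subseteq> X" "card Y \<le> DIM('a) + 1" "untranslatable K Y"
proof -
  define f where "f x = (\<lambda>k. k - x) ` interior K" for x
  have mem: "t \<in> f x \<longleftrightarrow> x + t \<in> interior K" for t x
  proof
    assume "x + t \<in> interior K"
    then show "t \<in> f x" unfolding f_def by (intro image_eqI[of _ _ "x + t"]) auto
  qed (auto simp: f_def)
  have U: "untranslatable K Y \<longleftrightarrow> \<Inter> (f ` Y) = {}" for Y
  proof -
    have "\<Inter> (f ` Y) = {t. \<forall>x\<in>Y. x + t \<in> interior K}" using mem by auto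
    then show ?thesis by (auto simp: untranslatable_def)
  qed
  \<comment> \<open>Helly's theorem needs a family of at least \<open>d + 1\<close> sets; a smaller family can be kept whole.\<close>
  have "\<exists>G. G \<subseteq> f ` X \<and> card G \<le> DIM('a) + 1 \<and> \<Inter> G = {}"
  proof (cases "card (f ` X) \<le> DIM('a) + 1")
    case True
    then show ?thesis using U assms(3) by blast
  next
    case False
    have convex: "\<forall>s\<in>f ` X. convex s"
      using assms(1) by (auto simp: f_def intro!: convex_translation_subtract)
    show ?thesis
    proof (rule ccontr)
      assume "\<not> ?thesis"
      then have "\<Inter> (f ` X) \<noteq> {}"
        using Helly[OF _ convex] False by fastforce
      then show False using U assms(3) by blast
    qed
  qed
  then obtain G where G: "G \<subseteq> f ` X" "card G \<le> DIM('a) + 1" "\<Inter> G = {}" by blast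
  then obtain Y where "Y \<subseteq> X" "inj_on f Y" "G = f ` Y" by (auto simp: subset_image_inj)
  then show thesis using that[of Y] G U by (simp add: card_image)
qed

text \<open>A property of one vertex of a closed polygon need only be shown for the head of the list. The
vertices are addressed by index here because a polygon may visit a point more than once.\<close>

lemma rotate_to_front:
  assumes "i < length xs"
  obtains ys where "rotate i xs = xs ! i # ys" "set ys = (!) xs ` ({..<length xs} - {i})"
proof -
  have "rotate i xs = drop i xs @ take i xs" using assms by (simp add: rotate_drop_take)
  also have "\<dots> = xs ! i # (drop (Suc i) xs @ take i xs)"
    using assms by (simp add: Cons_nth_drop_Suc[symmetric])
  finally have "rotate i xs = xs ! i # (drop (Suc i) xs @ take i xs)" .
  moreover have "set (drop (Suc i) xs @ take i xs) = (!) xs ` ({..<length xs} - {i})"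
  proof -
    have "set (take i xs) = (!) xs ` {..<i}"
      using assms by (simp add: nth_image[symmetric] lessThan_atLeast0)
    moreover have "set (drop (Suc i) xs) = (!) xs ` {Suc i..<length xs}"
      using assms by (auto simp: set_conv_nth image_iff) (metis add_diff_inverse_nat add_Suc diff_less_mono linorder_not_less)
    moreover have "{..<length xs} - {i} = {..<i} \<union> {Suc i..<length xs}" using assms by auto
    ultimately show ?thesis by (simp add: image_Un Un_commute)
  qed
  ultimately show thesis using that by blast
qed

text \<open>A polygon with too many vertices has one that Helly's theorem does not need; rotate it to the
front and drop it. The triangle inequality shows that the perimeter does not grow.\<close>

lemma shorten_polygon:
  fixes K :: "'a::euclidean_space set"
  assumes "convex K" "untranslatable K (set rs)"
  shows "\<exists>rs'. length rs' \<le> DIM('a) + 1 \<and> untranslatable K (set rs') \<and> perimeter rs' \<le> perimeter rs"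
  using assms(2)
proof (induction "length rs" arbitrary: rs rule: less_induct)
  case less
  show ?case
  proof (cases "length rs \<le> DIM('a) + 1")
    case True
    then show ?thesis using less.prems by blast
  next
    case False
    obtain Y where Y: "Y \<subseteq> set rs" "card Y \<le> DIM('a) + 1" "untranslatable K Y"
      using untranslatable_helly[OF assms(1) _ less.prems] by blast
    obtain I where I: "I \<subseteq> {..<length rs}" "inj_on ((!) rs) I" "Y = (!) rs ` I"
      using Y(1) by (auto simp: set_conv_nth subset_image_inj image_Collect[symmetric] 
          lessThan_def simp flip: image_Collect)
    have "card I < card {..<length rs}" using I Y(2) False by (simp add: card_image)
    then obtain i where i: "i < length rs" "i \<notin> I"
      by (metis I(1) card_mono finite_lessThan leD lessThan_iff subsetI finite_subset)
    obtain ys where ys: "rotate i rs = rs ! i # ys"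
      "set ys = (!) rs ` ({..<length rs} - {i})" using rotate_to_front[OF i(1)] by blast
    have "Y \<subseteq> set ys" using I i by (auto simp: ys(2))
    then have ut: "untranslatable K (set ys)" using Y(3) untranslatable_mono by blast
    have "length ys < length rs"
      using ys(1) by (metis length_Cons length_rotate lessI)
    moreover have "perimeter ys \<le> perimeter rs"
      using perimeter_tl_le[of ys "rs ! i"] untranslatable_nonempty[OF ut] ys(1)
        perimeter_rotate[of i rs] by simp
    ultimately show ?thesis using less.hyps[OF _ ut] by fastforce
  qed
qed

section \<open>Shortest polygons that do not fit\<close>

lemma perimeter_coordinates_continuous:
  "continuous_on UNIV (\<lambda>q::nat \<Rightarrow> 'a::euclidean_space. perimeter (map q is))"
proof -
  have "continuous_on UNIV (\<lambda>q::nat \<Rightarrow> 'a. path_length (map q is))"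
  proof (induction "is" rule: induct_list012)
    case (3 x y zs)
    then show ?case
      by (simp, intro continuous_intros continuous_on_product_coordinates) simp
  qed auto
  moreover have "continuous_on UNIV (\<lambda>q::nat \<Rightarrow> 'a. dist (last (map q is)) (hd (map q is)))"
    by (cases "is = []")
      (auto simp: last_map list.map_sel intro!: continuous_intros continuous_on_product_coordinates)
  ultimately show ?thesis unfolding perimeter_def by (rule continuous_on_add)
qed

text \<open>For a fixed translation, leaving the open set \<open>interior K\<close> is a closed condition on the vertices.\<close>

lemma untranslatable_coordinates_closed:
  fixes K :: "'a::euclidean_space set"
  assumes "finite J"
  shows "closed {q::nat \<Rightarrow> 'a. untranslatable K (q ` J)}"
proof -
  have "{q. untranslatable K (q ` J)} = (\<Inter>t. \<Union>i\<in>J. {q. q i + t \<in> - interior K})"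
    by (auto simp: untranslatable_def)
  moreover have "closed {q::nat \<Rightarrow> 'a. q i + t \<in> - interior K}" for i t
  proof -
    have "continuous_on UNIV (\<lambda>q::nat \<Rightarrow> 'a. q i + t)"
      by (intro continuous_intros continuous_on_product_coordinates)
    then have "closed ((\<lambda>q::nat \<Rightarrow> 'a. q i + t) -` (- interior K))"
      by (intro continuous_closed_vimage) (auto simp: continuous_on_eq_continuous_at)
    then show ?thesis by (simp add: vimage_def)
  qed
  ultimately show ?thesis using assms by (auto intro!: closed_INT closed_UN)
qed

text \<open>Padding by repeated copies of the first vertex gives all polygons the same number of vertices, and
translating the first vertex to the origin bounds the others by the perimeter. The value \<open>0\<close> beyond
the last vertex keeps the vertex functions in a compact product.\<close>

lemma polygon_normal_form:
  fixes K :: "'a::euclidean_space set"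
  assumes "convex K" "untranslatable K (set rs)"
  obtains q :: "nat \<Rightarrow> 'a" where "q 0 = 0" "\<And>i. DIM('a) + 1 \<le> i \<Longrightarrow> q i = 0"
    "untranslatable K (q ` {..<DIM('a) + 1})" "perimeter (map q [0..<DIM('a) + 1]) \<le> perimeter rs"
proof -
  define M where "M = DIM('a) + 1"
  obtain rs' where rs': "length rs' \<le> M" "untranslatable K (set rs')" "perimeter rs' \<le> perimeter rs"
    unfolding M_def using shorten_polygon[OF assms] by blast
  then obtain x ys where xy: "rs' = x # ys"
    using untranslatable_nonempty[of K "set rs'"] by (cases rs') auto
  define zs where "zs = map (\<lambda>y. y + - x) (replicate (M - length rs') x @ x # ys)"
  define q where "q i = (if i < M then zs ! i else 0)" for i
  have len: "length zs = M" using rs'(1) by (simp add: zs_def xy)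
  then have zs: "map q [0..<M] = zs" by (intro nth_equalityI) (auto simp: q_def)
  have "set zs = (\<lambda>y. y + - x) ` set rs'" by (auto simp: zs_def xy)
  moreover have "q ` {..<M} = set zs" 
    by (metis atLeast_upt list.set_map zs)
  ultimately have "untranslatable K (q ` {..<M})"
    using rs'(2) untranslatable_translation[of K "- x" "set rs'"] by simp
  moreover have "perimeter zs = perimeter rs'"
    unfolding zs_def using perimeter_affine[of "replicate (M - length rs') x @ x # ys" 1 "- x"]
    by (simp add: perimeter_replicate xy)
  moreover have "q 0 = 0"
    by (cases "M - length rs'") (auto simp: q_def zs_def M_def)
  ultimately show thesis
    using that[of q] zs rs'(3) unfolding M_def[symmetric] by (auto simp: q_def)
qed

text \<open>Among the shortest polygons the fewest vertices are required: this is what excludes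
vertices with zero normal and vertices on the segment between their neighbours.\<close>

definition optimal_polygon :: "'a::euclidean_space set \<Rightarrow> 'a list \<Rightarrow> bool" where
  "optimal_polygon K xs \<longleftrightarrow> untranslatable K (set xs) \<and>
     (\<forall>rs. untranslatable K (set rs) \<longrightarrow> perimeter xs \<le> perimeter rs \<and>
        (perimeter rs = perimeter xs \<longrightarrow> length xs \<le> length rs))"

text \<open>Two points at a distance larger than the diameter of \<open>K\<close> do not fit into \<open>K\<close>.\<close>

lemma untranslatable_exists:
  fixes K :: "'a::euclidean_space set"
  assumes "bounded K"
  shows "\<exists>rs. untranslatable K (set rs)"
proof -
  obtain b where b: "\<And>x. x \<in> K \<Longrightarrow> norm x < b" "0 < b"
    using assms by (meson bounded_pos_less)
  obtain e :: 'a where e: "norm e = 2 * b" using b(2) vector_choose_size[of "2 * b"] by auto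
  have "untranslatable K (set [0, e])"
  proof -
    { fix t assume t: "t \<in> interior K" "e + t \<in> interior K"
      then have "norm t < b" "norm (e + t) < b" using b interior_subset by blast+
      moreover have "norm e \<le> norm (e + t) + norm t"
        using norm_triangle_ineq4[of "e + t" t] by simp
      ultimately have False using e by simp }
    then show ?thesis by (auto simp: untranslatable_def)
  qed
  then show ?thesis by blast
qed

text \<open>The perimeter attains its minimum on the normal forms whose vertices are no farther from the origin
than the perimeter of a fixed polygon \<open>rs0\<close>. This minimum is a lower bound for polygons with any
number of vertices, because each one no longer than \<open>rs0\<close> has such a normal form.\<close>

lemma optimal_polygon_exists:
  fixes K :: "'a::euclidean_space set"
  assumes "convex K" "bounded K"
  obtains xs where "optimal_polygon K xs" "length xs \<le> DIM('a) + 1"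
proof -
  define M where "M = DIM('a) + 1"
  define peri where "peri q = perimeter (map q [0..<M])" for q :: "nat \<Rightarrow> 'a"
  obtain rs0 where rs0: "untranslatable K (set rs0)" using untranslatable_exists[OF assms(2)] ..
  define C where "C = (\<Pi>\<^sub>E i\<in>UNIV. if i < M then cball 0 (perimeter rs0) else {0::'a})
     \<inter> {q. untranslatable K (q ` {..<M})}"
  have norm_form: "\<exists>q\<in>C. peri q \<le> perimeter rs"
    if rs: "untranslatable K (set rs)" "perimeter rs \<le> perimeter rs0" for rs
  proof -
    obtain q :: "nat \<Rightarrow> 'a" where q: "q 0 = 0" "\<And>i. M \<le> i \<Longrightarrow> q i = 0" 
      "untranslatable K (q ` {..<M})" "peri q \<le> perimeter rs"
      using polygon_normal_form[OF assms(1) rs(1)] unfolding M_def peri_def by metis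
    have "norm (q i) \<le> perimeter rs0" if "i < M" for i
    proof -
      have "hd (map q [0..<M]) = 0" using q(1) by (simp add: M_def upt_conv_Cons del: upt_Suc)
      then have "norm (q i) \<le> peri q"
        using dist_hd_le_perimeter[of "q i" "map q [0..<M]"] that by (simp add: peri_def)
      then show ?thesis using q(4) rs(2) by linarith
    qed
    then have "q \<in> C" using q by (auto simp: C_def)
    then show ?thesis using q(4) by blast
  qed
  have "compact (\<Pi>\<^sub>E i\<in>UNIV. if i < M then cball 0 (perimeter rs0) else {0::'a})"
  proof -
    have "compactin (product_topology (\<lambda>i::nat. euclidean) UNIV)
       (\<Pi>\<^sub>E i\<in>UNIV. if i < M then cball 0 (perimeter rs0) else {0::'a})"
      by (subst compactin_PiE) auto
    then show ?thesis by (simp add: euclidean_product_topology)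
  qed
  then have "compact C" unfolding C_def
    by (intro compact_Int_closed untranslatable_coordinates_closed) auto
  moreover have "C \<noteq> {}" using norm_form[OF rs0] by blast
  moreover have "continuous_on C peri" unfolding peri_def
    by (rule continuous_on_subset[OF perimeter_coordinates_continuous]) auto
  ultimately obtain q0 where q0: "q0 \<in> C" "\<And>q. q \<in> C \<Longrightarrow> peri q0 \<le> peri q"
    using continuous_attains_inf[of C peri] by blast
  have le: "peri q0 \<le> perimeter rs" if "untranslatable K (set rs)" for rs
  proof (cases "perimeter rs \<le> perimeter rs0")
    case True
    then show ?thesis using norm_form[OF that] q0(2) by fastforce
  next
    case False
    then show ?thesis using norm_form[OF rs0] q0(2) by fastforce
  qed
  define P where "P xs \<longleftrightarrow> untranslatable K (set xs) \<and> perimeter xs = peri q0" for xs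
  have P0: "P (map q0 [0..<M])"
    using q0(1) by (simp add: P_def peri_def C_def lessThan_atLeast0)
  define xs where "xs = arg_min length P"
  have xs: "P xs" "\<And>rs. P rs \<Longrightarrow> length xs \<le> length rs"
    using arg_min_nat_lemma[of P _ length, OF P0] by (auto simp: xs_def)
  have "length xs \<le> M" using xs(2)[OF P0] by simp
  moreover have "optimal_polygon K xs"
    using xs le unfolding P_def optimal_polygon_def by auto
  ultimately show thesis using that unfolding M_def by blast
qed

lemma optimal_polygon_rotate: "optimal_polygon K xs \<Longrightarrow> optimal_polygon K (rotate n xs)"
  by (simp add: optimal_polygon_def perimeter_rotate)

lemma optimal_polygon_translate:
  assumes "optimal_polygon K xs"
  shows "optimal_polygon K (map (\<lambda>x. x + t) xs)"
proof -
  have "xs \<noteq> []" using assms untranslatable_nonempty unfolding optimal_polygon_def by fastforce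
  then have "perimeter (map (\<lambda>x. x + t) xs) = perimeter xs"
    using perimeter_affine[of xs 1 t] by simp
  then show ?thesis using assms by (simp add: optimal_polygon_def untranslatable_translation)
qed

lemma optimal_polygon_tl_translatable:
  assumes "optimal_polygon K (x # ys)"
  shows "\<not> untranslatable K (set ys)"
proof
  assume ut: "untranslatable K (set ys)"
  then have "perimeter ys \<le> perimeter (x # ys)"
    using untranslatable_nonempty[OF ut] perimeter_tl_le by fastforce
  then show False using assms ut unfolding optimal_polygon_def
    by (metis antisym length_Cons not_less_eq_eq order_refl)
qed

lemma optimal_polygon_hd_notin_hull:
  assumes "convex K" "optimal_polygon K (x # ys)"
  shows "x \<notin> convex hull set ys"
  using untranslatable_remove_hull_point[of K x "set ys"] assms
    optimal_polygon_tl_translatable[OF assms(2)] by (auto simp: optimal_polygon_def)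

lemma optimal_polygon_tl_nonempty:
  assumes "interior K \<noteq> {}" "optimal_polygon K (x # ys)"
  shows "ys \<noteq> []"
proof
  assume "ys = []"
  moreover obtain z where "z \<in> interior K" using assms(1) by blast
  ultimately have "x + (z - x) \<in> interior K" "set (x # ys) = {x}" by auto
  then show False using assms(2) unfolding optimal_polygon_def untranslatable_def by (metis singletonD)
qed

lemma optimal_polygon_hd_notin_segment:
  assumes "convex K" "interior K \<noteq> {}" "optimal_polygon K (x # ys)"
  shows "x \<notin> closed_segment (last ys) (hd ys)"
proof -
  have "ys \<noteq> []" using optimal_polygon_tl_nonempty[OF assms(2,3)] .
  then have "closed_segment (last ys) (hd ys) \<subseteq> convex hull (set ys)"
    by (intro closed_segment_subset) (auto intro: hull_inc)
  then show ?thesis using optimal_polygon_hd_notin_hull[OF assms(1,3)] by blast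
qed

text \<open>A copy scaled by \<open>c < 1\<close> is shorter, hence can be moved into the interior of \<open>K\<close>. As \<open>c\<close> tends
to \<open>1\<close>, the translations have a limit point, and it moves the polygon itself into the closed set
\<open>K\<close>.\<close>

lemma optimal_polygon_fits:
  fixes K :: "'a::euclidean_space set"
  assumes "convex_body K" "optimal_polygon K xs"
  obtains t where "\<forall>x\<in>set xs. x + t \<in> K"
proof -
  have cK: "compact K" "convex K" "interior K \<noteq> {}" using assms(1) by (auto simp: convex_body_def)
  have "xs \<noteq> []" using assms(2) untranslatable_nonempty unfolding optimal_polygon_def by fastforce
  then obtain x ys where xs: "xs = x # ys" by (cases xs) auto
  have ys: "ys \<noteq> []" using optimal_polygon_tl_nonempty[OF cK(3)] assms(2) xs by blast
  then have "hd ys \<noteq> x"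
    using optimal_polygon_hd_notin_hull[OF cK(2)] assms(2) xs hull_inc[of "hd ys" "set ys" convex]
    by (metis list.set_sel(1))
  then have pos: "0 < perimeter xs"
    using ys path_length_nonneg[of ys] by (simp add: xs perimeter_Cons add_pos_nonneg)
  define c where "c n = 1 - 1 / real (n + 2)" for n
  have c: "0 < c n" "c n < 1" for n by (auto simp: c_def)
  have "\<exists>t. \<forall>y\<in>set xs. c n *\<^sub>R y + t \<in> interior K" for n
  proof (rule ccontr)
    assume "\<not> ?thesis"
    then have "untranslatable K (set (map (\<lambda>y. c n *\<^sub>R y + 0) xs))"
      by (auto simp: untranslatable_def)
    moreover have "perimeter (map (\<lambda>y. c n *\<^sub>R y + 0) xs) < perimeter xs"
      using c[of n] pos \<open>xs \<noteq> []\<close> by (subst perimeter_affine) auto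
    ultimately show False using assms(2) unfolding optimal_polygon_def by fastforce
  qed
  then obtain t where t: "\<And>n y. y \<in> set xs \<Longrightarrow> c n *\<^sub>R y + t n \<in> K"
    by (metis interior_subset subset_iff)
  have "\<forall>n. c n *\<^sub>R x + t n \<in> K" using t xs by simp
  then obtain l r where r: "strict_mono r" "((\<lambda>n. c n *\<^sub>R x + t n) \<circ> r) \<longlonglongrightarrow> l"
    using seq_compactE[OF compact_imp_seq_compact[OF cK(1)], of "\<lambda>n. c n *\<^sub>R x + t n"] by blast
  have "c \<longlonglongrightarrow> 1 - 0" unfolding c_def
    by (intro tendsto_diff tendsto_const LIMSEQ_ignore_initial_segment[OF lim_1_over_n])
  then have cr: "(\<lambda>n. c (r n)) \<longlonglongrightarrow> 1" using LIMSEQ_subseq_LIMSEQ[OF _ r(1)] by (auto simp: o_def)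
  have "y + (l - x) \<in> K" if "y \<in> set xs" for y
  proof -
    have "(\<lambda>n. (c (r n) *\<^sub>R x + t (r n)) + c (r n) *\<^sub>R (y - x)) \<longlonglongrightarrow> l + 1 *\<^sub>R (y - x)"
      using r(2) cr by (intro tendsto_intros) (auto simp: o_def)
    moreover have "(c (r n) *\<^sub>R x + t (r n)) + c (r n) *\<^sub>R (y - x) \<in> K" for n
      using t[OF that, of "r n"] by (simp add: algebra_simps)
    ultimately have "l + 1 *\<^sub>R (y - x) \<in> K"
      by (rule closed_sequentially[OF compact_imp_closed[OF cK(1)], rotated])
    then show ?thesis by (simp add: algebra_simps)
  qed
  then show thesis using that by blast
qed

section \<open>Balanced outer normals\<close>

lemma normal_cone_interior_less:
  assumes "n \<in> normal_cone K q" "n \<noteq> 0" "z \<in> interior K"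
  shows "n \<bullet> (z - q) < 0"
proof -
  obtain e where e: "0 < e" "cball z e \<subseteq> K" using assms(3) by (meson mem_interior_cball)
  define s where "s = e / norm n"
  have s: "0 < s" using e(1) assms(2) by (simp add: s_def)
  have "z + s *\<^sub>R n \<in> K" using e assms(2) by (auto simp: s_def dist_norm)
  then have "n \<bullet> (z + s *\<^sub>R n - q) \<le> 0" using assms(1) by (simp add: normal_cone_def)
  moreover have "n \<bullet> (z + s *\<^sub>R n - q) = n \<bullet> (z - q) + s * (n \<bullet> n)"
    by (simp add: algebra_simps)
  moreover have "0 < s * (n \<bullet> n)" using s assms(2) by simp
  ultimately show ?thesis by linarith
qed

lemma normal_cone_sum:
  assumes "\<And>i. i \<in> I \<Longrightarrow> f i \<in> normal_cone K q"
  shows "sum f I \<in> normal_cone K q"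
  using assms by (auto simp: normal_cone_def inner_sum_left intro!: sum_nonpos)

lemma normal_cone_scaleR: "a \<in> normal_cone K q \<Longrightarrow> 0 \<le> c \<Longrightarrow> c *\<^sub>R a \<in> normal_cone K q"
  by (simp add: normal_cone_def mult_nonneg_nonpos)

lemma zero_in_normal_cone: "0 \<in> normal_cone K q"
  by (simp add: normal_cone_def)

lemma closed_normal_cone: "closed (normal_cone K q)"
proof -
  have "normal_cone K q = (\<Inter>q'\<in>K. {n. (q' - q) \<bullet> n \<le> 0})"
    by (auto simp: normal_cone_def inner_commute)
  then show ?thesis by (auto intro!: closed_INT closed_halfspace_le)
qed

text \<open>Otherwise a hyperplane separates the interior from the open ray in direction \<open>v\<close>. It passes
through \<open>q\<close>, so its normal lies in the normal cone, and it does not decrease along \<open>v\<close>.\<close>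

lemma enters_interior:
  fixes K :: "'a::euclidean_space set"
  assumes "convex K" "interior K \<noteq> {}" "q \<in> K"
    and v: "\<And>n. n \<in> normal_cone K q \<Longrightarrow> n \<noteq> 0 \<Longrightarrow> n \<bullet> v < 0"
  obtains e where "0 < e" "\<And>s. 0 < s \<Longrightarrow> s \<le> e \<Longrightarrow> q + s *\<^sub>R v \<in> interior K"
proof -
  have "\<exists>e>0. q + e *\<^sub>R v \<in> interior K"
  proof (rule ccontr)
    assume no: "\<not> ?thesis"
    define R where "R = (\<lambda>s. q + s *\<^sub>R v) ` {0<..}"
    have "convex ((+) q ` (\<lambda>s. s *\<^sub>R v) ` {0::real<..})"
      by (intro convex_translation convex_linear_image) (auto intro: linearI simp: algebra_simps)
    then have "convex R" by (simp add: R_def image_image)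
    moreover have "interior K \<inter> R = {}" using no by (auto simp: R_def)
    moreover have "R \<noteq> {}" by (auto simp: R_def)
    ultimately obtain a b where ab: "a \<noteq> 0" "\<forall>x\<in>interior K. a \<bullet> x \<le> b" "\<forall>x\<in>R. a \<bullet> x \<ge> b"
      using separating_hyperplane_sets[of "interior K" R] assms(1,2) convex_interior by blast
    have "K \<subseteq> {x. a \<bullet> x \<le> b}"
    proof -
      have "closure (interior K) \<subseteq> {x. a \<bullet> x \<le> b}"
        using ab(2) by (intro closure_minimal closed_halfspace_le) auto
      then show ?thesis using convex_closure_interior[OF assms(1,2)] closure_subset by blast
    qed
    then have le: "a \<bullet> x \<le> b" if "x \<in> K" for x using that by blast
    have ge: "b \<le> a \<bullet> q + s * (a \<bullet> v)" if "0 < s" for s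
      using ab(3) that by (auto simp: R_def inner_add_right)
    have "((\<lambda>s. a \<bullet> q + s * (a \<bullet> v)) \<longlongrightarrow> a \<bullet> q + 0 * (a \<bullet> v)) (at_right 0)"
      by (intro tendsto_intros)
    then have "b \<le> a \<bullet> q + 0 * (a \<bullet> v)"
      by (rule tendsto_lowerbound) (auto simp: eventually_at_right_less ge intro!: eventually_mono[OF eventually_at_right_less[of 0]])
    then have "a \<bullet> q = b" using le[OF assms(3)] by simp
    then have "a \<in> normal_cone K q" using le by (simp add: normal_cone_def inner_diff_right)
    then have "a \<bullet> v < 0" using v ab(1) by blast
    then show False using ge[of 1] \<open>a \<bullet> q = b\<close> by simp
  qed
  then obtain e where e: "0 < e" "q + e *\<^sub>R v \<in> interior K" by blast
  have "q + s *\<^sub>R v \<in> interior K" if "0 < s" "s \<le> e" for s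
  proof -
    have "q - (s / e) *\<^sub>R (q - (q + e *\<^sub>R v)) \<in> interior K"
      by (rule mem_interior_convex_shrink[OF assms(1) e(2) assms(3)]) (use that e in auto)
    then show ?thesis using e(1) by (simp add: algebra_simps)
  qed
  then show thesis using that e(1) by blast
qed

text \<open>If the origin is not in the convex hull of the unit normals at the points of \<open>X\<close>, then some vector
has negative inner product with all of them, and a small translation along it moves \<open>X\<close>
into the interior. So the origin is a convex combination of unit normals, and collecting the
normals that belong to the same point gives the balanced family.\<close>

lemma balanced_normals_exist:
  fixes K :: "'a::euclidean_space set"
  assumes "convex K" "interior K \<noteq> {}" "finite X" "X \<subseteq> K" "untranslatable K X"
  obtains n where "\<And>x. x \<in> X \<Longrightarrow> n x \<in> normal_cone K x" "(\<Sum>x\<in>X. n x) = 0" "\<exists>x\<in>X. n x \<noteq> 0"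
proof -
  define G where "G = (\<Union>x\<in>X. normal_cone K x \<inter> sphere 0 1)"
  have "compact G" unfolding G_def using assms(3)
    by (intro compact_UN closed_Int_compact closed_normal_cone) auto
  have "0 \<in> convex hull G"
  proof (rule ccontr)
    assume "0 \<notin> convex hull G"
    then obtain a b where ab: "0 < b" "\<forall>g\<in>convex hull G. a \<bullet> g > b"
      using separating_hyperplane_closed_0[of "convex hull G"] compact_convex_hull[OF \<open>compact G\<close>]
        compact_imp_closed by (metis convex_convex_hull)
    have neg: "m \<bullet> (- a) < 0" if "x \<in> X" "m \<in> normal_cone K x" "m \<noteq> 0" for x m
    proof -
      have "(1 / norm m) *\<^sub>R m \<in> G" unfolding G_def
        using that by (auto intro!: bexI[of _ x] normal_cone_scaleR)
      then have "a \<bullet> ((1 / norm m) *\<^sub>R m) > b" using ab(2) hull_inc by metis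
      then have "0 < a \<bullet> m / norm m" using ab(1) by simp
      then show ?thesis using that(3) by (simp add: zero_less_divide_iff inner_commute)
    qed
    have "\<forall>x\<in>X. \<exists>e>0. \<forall>s. 0 < s \<longrightarrow> s \<le> e \<longrightarrow> x + s *\<^sub>R (- a) \<in> interior K"
    proof
      fix x assume x: "x \<in> X"
      then have "x \<in> K" using assms(4) by blast
      from enters_interior[OF assms(1,2) this neg[OF x]]
      show "\<exists>e>0. \<forall>s. 0 < s \<longrightarrow> s \<le> e \<longrightarrow> x + s *\<^sub>R (- a) \<in> interior K" by metis
    qed
    then obtain e where e: "\<And>x. x \<in> X \<Longrightarrow> 0 < e x"
      "\<And>x s. x \<in> X \<Longrightarrow> 0 < s \<Longrightarrow> s \<le> e x \<Longrightarrow> x + s *\<^sub>R (- a) \<in> interior K" by metis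
    have "X \<noteq> {}" using untranslatable_nonempty[OF assms(5)] .
    define s where "s = Min (e ` X)"
    have "0 < s" "\<And>x. x \<in> X \<Longrightarrow> s \<le> e x"
      using assms(3) \<open>X \<noteq> {}\<close> e(1) by (auto simp: s_def)
    then have "\<forall>x\<in>X. x + s *\<^sub>R (- a) \<in> interior K" using e(2) by blast
    then show False using assms(5) unfolding untranslatable_def by blast
  qed
  then obtain S u where Su: "finite S" "S \<subseteq> G" "\<forall>g\<in>S. 0 \<le> u g" "sum u S = 1"
    "(\<Sum>g\<in>S. u g *\<^sub>R g) = 0"
    by (auto simp: convex_hull_explicit)
  have "\<forall>g\<in>S. \<exists>x\<in>X. g \<in> normal_cone K x \<and> norm g = 1" using Su(2) by (auto simp: G_def)
  then obtain f where f: "\<And>g. g \<in> S \<Longrightarrow> f g \<in> X"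
    "\<And>g. g \<in> S \<Longrightarrow> g \<in> normal_cone K (f g)" "\<And>g. g \<in> S \<Longrightarrow> norm g = 1" by metis
  define n where "n x = (\<Sum>g\<in>{g\<in>S. f g = x}. u g *\<^sub>R g)" for x
  have "n x \<in> normal_cone K x" for x
    unfolding n_def using f Su by (intro normal_cone_sum normal_cone_scaleR) auto
  moreover have "(\<Sum>x\<in>X. n x) = 0"
    unfolding n_def using Su(1,5) assms(3) f(1) by (subst sum.group) auto
  \<comment> \<open>The unit normals at one point cannot cancel: they are all negative on \<open>z - f g0\<close> for an
    interior point \<open>z\<close>.\<close>
  moreover have "\<exists>x\<in>X. n x \<noteq> 0"
  proof -
    obtain g0 where g0: "g0 \<in> S" "u g0 \<noteq> 0" using Su(4) by (metis sum.neutral zero_neq_one)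
    obtain z where z: "z \<in> interior K" using assms(2) by blast
    have lt: "g \<bullet> (z - f g) < 0" if "g \<in> S" for g
      using normal_cone_interior_less[OF f(2)[OF that] _ z] f(3)[OF that] by fastforce
    have "n (f g0) \<bullet> (z - f g0) = (\<Sum>g\<in>{g\<in>S. f g = f g0}. u g * (g \<bullet> (z - f g)))"
      unfolding n_def inner_sum_left by (rule sum.cong) auto
    also have "\<dots> < 0"
    proof -
      have "0 < (\<Sum>g\<in>{g\<in>S. f g = f g0}. - (u g * (g \<bullet> (z - f g))))"
      proof (rule sum_pos2[of _ g0])
        have "0 < u g0" using g0 Su(3) by force
        then show "0 < - (u g0 * (g0 \<bullet> (z - f g0)))" using lt[OF g0(1)] by (simp add: mult_pos_neg)
        show "0 \<le> - (u i * (i \<bullet> (z - f i)))" if "i \<in> {g\<in>S. f g = f g0}" for i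
          using that lt[of i] Su(3) by (simp add: mult_nonneg_nonpos)
      qed (use Su(1) g0 in auto)
      then show ?thesis by (simp add: sum_negf)
    qed
    finally show ?thesis using f(1)[OF g0(1)] by force
  qed
  ultimately show thesis using that by blast
qed

text \<open>The vertex \<open>q\<close> is replaced by two points \<open>q1\<close> and \<open>q2\<close>, on the outer sides of the
hyperplanes through \<open>q\<close> with normals \<open>a\<close> and \<open>b\<close>. A translation \<open>t\<close> into the interior has negative inner product with every
nonzero normal, which is impossible because the normals sum to zero. Taking \<open>b = 0\<close>
or \<open>q1 = q2\<close> covers moving a vertex without splitting it.\<close>

lemma untranslatable_split_vertex:
  fixes K :: "'a::euclidean_space set"
  assumes "finite Y" and n: "\<And>y. y \<in> Y \<Longrightarrow> n y \<in> normal_cone K y"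
    and AB: "a \<in> normal_cone K q" "b \<in> normal_cone K q"
    and sum: "a + b + (\<Sum>y\<in>Y. n y) = 0"
    and nz: "a \<noteq> 0 \<or> b \<noteq> 0 \<or> (\<exists>y\<in>Y. n y \<noteq> 0)"
    and moved: "0 \<le> a \<bullet> (q1 - q)" "0 \<le> b \<bullet> (q2 - q)"
  shows "untranslatable K (insert q1 (insert q2 Y))"
  unfolding untranslatable_def
proof
  assume "\<exists>t. \<forall>x\<in>insert q1 (insert q2 Y). x + t \<in> interior K"
  then obtain t where t: "q1 + t \<in> interior K" "q2 + t \<in> interior K" "\<And>y. y \<in> Y \<Longrightarrow> y + t \<in> interior K"
    by blast
  have key: "m \<bullet> t \<le> 0 \<and> (m \<noteq> 0 \<longrightarrow> m \<bullet> t < 0)"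
    if "m \<in> normal_cone K z" "z' + t \<in> interior K" "0 \<le> m \<bullet> (z' - z)" for m z z'
  proof -
    have "m \<bullet> (z' + t - z) = m \<bullet> (z' - z) + m \<bullet> t" by (simp add: algebra_simps)
    then show ?thesis using normal_cone_interior_less[OF that(1) _ that(2)] that(3) by fastforce
  qed
  have a: "a \<bullet> t \<le> 0" "a \<noteq> 0 \<Longrightarrow> a \<bullet> t < 0" using key[OF AB(1) t(1) moved(1)] by auto
  have b: "b \<bullet> t \<le> 0" "b \<noteq> 0 \<Longrightarrow> b \<bullet> t < 0" using key[OF AB(2) t(2) moved(2)] by auto
  have y: "n y \<bullet> t \<le> 0" "n y \<noteq> 0 \<Longrightarrow> n y \<bullet> t < 0" if "y \<in> Y" for y
    using key[OF n[OF that] t(3)[OF that]] by auto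
  have "(\<Sum>y\<in>Y. n y \<bullet> t) \<le> 0" by (rule sum_nonpos) (use y in blast)
  moreover have "a \<bullet> t + b \<bullet> t + (\<Sum>y\<in>Y. n y \<bullet> t) = 0"
    using arg_cong[OF sum, of "\<lambda>z. z \<bullet> t"] by (simp add: inner_add_left inner_sum_left)
  ultimately have "a \<bullet> t = 0" "b \<bullet> t = 0" "(\<Sum>y\<in>Y. n y \<bullet> t) = 0" using a(1) b(1) by linarith+
  moreover from this(3) have "\<forall>y\<in>Y. n y \<bullet> t = 0"
    using sum_nonneg_eq_0_iff[of Y "\<lambda>y. - (n y \<bullet> t)"] assms(1) y(1) by (auto simp: sum_negf)
  ultimately show False using nz a(2) b(2) y(2) by force
qed

section \<open>First variation of the perimeter\<close>

text \<open>With \<open>r = norm x\<close> and \<open>z = norm (x - s *\<^sub>R w)\<close> this is \<open>2 * r * z \<le> r\<^sup>2 + z\<^sup>2\<close>.\<close>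

lemma norm_diff_le_first_order:
  fixes x w :: "'a::euclidean_space"
  assumes "x \<noteq> 0"
  shows "norm (x - s *\<^sub>R w) \<le> norm x - s * (sgn x \<bullet> w) + s\<^sup>2 * ((norm w)\<^sup>2 / (2 * norm x))"
proof -
  define r z where "r = norm x" and "z = norm (x - s *\<^sub>R w)"
  have r: "0 < r" using assms by (simp add: r_def)
  have z2: "z\<^sup>2 = r\<^sup>2 - 2 * s * (x \<bullet> w) + s\<^sup>2 * (norm w)\<^sup>2"
    unfolding z_def r_def power2_norm_eq_inner
    by (simp add: inner_diff_left inner_diff_right inner_commute algebra_simps power2_eq_square)
  have "2 * r * z \<le> r\<^sup>2 + z\<^sup>2" using sum_squares_bound[of r z] by simp
  then have "z \<le> (r\<^sup>2 + z\<^sup>2) / (2 * r)" using r by (simp add: field_simps)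
  also have "\<dots> = r - s * (x \<bullet> w / r) + s\<^sup>2 * ((norm w)\<^sup>2 / (2 * r))"
    unfolding z2 using r by (simp add: field_simps power2_eq_square)
  also have "x \<bullet> w / r = sgn x \<bullet> w" by (simp add: r_def sgn_div_norm divide_inverse)
  finally show ?thesis by (simp only: r_def z_def)
qed

lemma split_vertex_shortens:
  fixes x p s w1 w2 :: "'a::euclidean_space"
  assumes "p \<noteq> x" "s \<noteq> x"
    and "norm (w1 - w2) < sgn (p - x) \<bullet> w1 + sgn (s - x) \<bullet> w2"
  obtains e where "0 < e"
    "dist p (x + e *\<^sub>R w1) + dist (x + e *\<^sub>R w1) (x + e *\<^sub>R w2) + dist (x + e *\<^sub>R w2) s < dist p x + dist x s"
proof -
  define g where "g = sgn (p - x) \<bullet> w1 + sgn (s - x) \<bullet> w2 - norm (w1 - w2)"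
  define C where "C = (norm w1)\<^sup>2 / (2 * norm (p - x)) + (norm w2)\<^sup>2 / (2 * norm (s - x))"
  \<comment> \<open>\<open>g\<close> is the first-order gain per unit step and \<open>C\<close> bounds the quadratic error, so the step
    only has to satisfy \<open>e * C < g\<close>.\<close>
  define e where "e = g / (C + 1)"
  have g: "0 < g" using assms(3) by (simp add: g_def)
  have C: "0 \<le> C" by (simp add: C_def)
  have e: "0 < e" using g C by (simp add: e_def)
  have "e * C < g" using g C by (simp add: e_def field_simps)
  then have small: "e\<^sup>2 * C < e * g" using e by (simp add: power2_eq_square)
  have 1: "dist p (x + e *\<^sub>R w1) \<le> dist p x - e * (sgn (p - x) \<bullet> w1)
      + e\<^sup>2 * ((norm w1)\<^sup>2 / (2 * norm (p - x)))"
    using norm_diff_le_first_order[of "p - x" e w1] assms(1) by (simp add: dist_norm diff_diff_eq)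
  have 2: "dist s (x + e *\<^sub>R w2) \<le> dist s x - e * (sgn (s - x) \<bullet> w2)
      + e\<^sup>2 * ((norm w2)\<^sup>2 / (2 * norm (s - x)))"
    using norm_diff_le_first_order[of "s - x" e w2] assms(2)
    by (simp add: dist_norm diff_diff_eq)
  have 3: "dist (x + e *\<^sub>R w1) (x + e *\<^sub>R w2) = e * norm (w1 - w2)"
    using e by (simp add: dist_norm flip: scaleR_diff_right)
  have "e\<^sup>2 * C = e\<^sup>2 * ((norm w1)\<^sup>2 / (2 * norm (p - x))) + e\<^sup>2 * ((norm w2)\<^sup>2 / (2 * norm (s - x)))"
    unfolding C_def by (rule distrib_left)
  moreover have "e * g = e * (sgn (p - x) \<bullet> w1) + e * (sgn (s - x) \<bullet> w2) - e * norm (w1 - w2)"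
    by (simp add: g_def algebra_simps)
  ultimately show thesis using that[OF e] 1 2 3 small
    by (simp only: dist_commute[of x s] dist_commute[of "x + e *\<^sub>R w2" s])
qed

text \<open>Both variations used below are instances: the reflection law moves a vertex as a whole (\<open>b = 0\<close>,
\<open>w1 = w2\<close>), and the argument at a non-smooth vertex separates it into two.\<close>

lemma optimal_polygon_split:
  fixes K :: "'a::euclidean_space set"
  assumes opt: "optimal_polygon K (x # ys)" and ys: "ys \<noteq> []" "last ys \<noteq> x" "hd ys \<noteq> x"
    and n: "\<And>y. y \<in> set ys \<Longrightarrow> n y \<in> normal_cone K y"
    and ab: "a \<in> normal_cone K x" "b \<in> normal_cone K x" "a + b \<noteq> 0"
    and sum: "a + b + (\<Sum>y\<in>set ys. n y) = 0"
    and w: "0 \<le> a \<bullet> w1" "0 \<le> b \<bullet> w2"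
  shows "sgn (last ys - x) \<bullet> w1 + sgn (hd ys - x) \<bullet> w2 \<le> norm (w1 - w2)"
proof (rule ccontr)
  assume "\<not> ?thesis"
  then obtain e where e: "0 < e"
    "dist (last ys) (x + e *\<^sub>R w1) + dist (x + e *\<^sub>R w1) (x + e *\<^sub>R w2) + dist (x + e *\<^sub>R w2) (hd ys)
      < dist (last ys) x + dist x (hd ys)"
    using split_vertex_shortens[OF ys(2,3)] by (metis not_le)
  let ?rs = "(x + e *\<^sub>R w1) # (x + e *\<^sub>R w2) # ys"
  have "untranslatable K (set ?rs)"
  proof -
    have nz: "a \<noteq> 0 \<or> b \<noteq> 0 \<or> (\<exists>y\<in>set ys. n y \<noteq> 0)" using ab(3) by auto
    have "untranslatable K (insert (x + e *\<^sub>R w1) (insert (x + e *\<^sub>R w2) (set ys)))"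
      by (rule untranslatable_split_vertex[where n = n and a = a and b = b and q = x])
        (use n ab(1,2) sum nz w e(1) in simp_all)
    then show ?thesis by simp
  qed
  then have "perimeter (x # ys) \<le> perimeter ?rs" using opt by (simp add: optimal_polygon_def)
  then show False using e(2) ys(1) by (simp add: perimeter_Cons path_length_Cons)
qed

lemma opposite_directions_in_segment:
  fixes x p s :: "'a::euclidean_space"
  assumes "p \<noteq> x" "s \<noteq> x" "sgn (p - x) + sgn (s - x) = 0"
  shows "x \<in> closed_segment p s"
proof -
  define a b where "a = norm (p - x)" and "b = norm (s - x)"
  have ab: "0 < a" "0 < b" using assms by (auto simp: a_def b_def)
  have "p - x = a *\<^sub>R sgn (p - x)" "s - x = b *\<^sub>R sgn (s - x)"
    using assms(1,2) by (auto simp: a_def b_def sgn_div_norm)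
  then have "b *\<^sub>R (p - x) + a *\<^sub>R (s - x) = (a * b) *\<^sub>R (sgn (p - x) + sgn (s - x))"
    by (metis mult.commute scaleR_add_right scaleR_scaleR)
  then have "(a + b) *\<^sub>R x = b *\<^sub>R p + a *\<^sub>R s" using assms(3) by (simp add: algebra_simps)
  then have "x = (1 / (a + b)) *\<^sub>R (b *\<^sub>R p + a *\<^sub>R s)" 
    using ab by (metis add_pos_pos divide_inverse_commute less_irrefl mult.right_neutral scaleR_one scaleR_scaleR right_inverse mult.commute)
  then have "x = (1 - a / (a + b)) *\<^sub>R p + (a / (a + b)) *\<^sub>R s"
    using ab by (simp add: scaleR_add_right field_simps)
  then show ?thesis using ab by (auto simp: in_segment intro!: exI[of _ "a / (a + b)"])
qed

text \<open>If the normal at \<open>x\<close> were zero, the other vertices would be balanced by themselves, so \<open>x\<close>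
could be dropped.\<close>

lemma optimal_polygon_normals:
  fixes K :: "'a::euclidean_space set"
  assumes K: "convex_body K" and opt: "optimal_polygon K (x # ys)" and sub: "set (x # ys) \<subseteq> K"
  obtains n where "\<And>y. y \<in> set (x # ys) \<Longrightarrow> n y \<in> normal_cone K y"
    "n x + (\<Sum>y\<in>set ys. n y) = 0" "n x \<noteq> 0"
proof -
  have cK: "convex K" "interior K \<noteq> {}" using K by (auto simp: convex_body_def)
  have "untranslatable K (set (x # ys))" using opt by (simp add: optimal_polygon_def)
  then obtain n where n: "\<And>y. y \<in> set (x # ys) \<Longrightarrow> n y \<in> normal_cone K y"
    "(\<Sum>y\<in>set (x # ys). n y) = 0" "\<exists>y\<in>set (x # ys). n y \<noteq> 0"
    using balanced_normals_exist[OF cK _ sub] by (metis List.finite_set)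
  have "x \<notin> set ys" using optimal_polygon_hd_notin_hull[OF cK(1) opt] hull_inc by metis
  then have sum: "n x + (\<Sum>y\<in>set ys. n y) = 0" using n(2) by simp
  have "n x \<noteq> 0"
  proof
    assume 0: "n x = 0"
    obtain y where y: "y \<in> set ys" "n y \<noteq> 0" using n(3) 0 by auto
    have "untranslatable K (insert y (insert y (set ys)))"
      by (rule untranslatable_split_vertex[where n = n and a = 0 and b = 0 and q = y])
        (use n sum 0 y zero_in_normal_cone in auto)
    then show False using y(1) optimal_polygon_tl_translatable[OF opt] by (simp add: insert_absorb)
  qed
  then show thesis using that n(1) sum by blast
qed

text \<open>On the half-space of directions \<open>h\<close> with \<open>n x \<bullet> h \<ge> 0\<close> the sum \<open>w\<close> of the two unit vectors has
\<open>w \<bullet> h \<le> 0\<close>. So the component \<open>r\<close> of \<open>w\<close> orthogonal to \<open>n x\<close> vanishes, and the coefficient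
of \<open>n x\<close> is not positive. It is not zero because \<open>x\<close> is not between its neighbours.\<close>

lemma optimal_polygon_reflects:
  fixes K :: "'a::euclidean_space set"
  assumes K: "convex_body K" and opt: "optimal_polygon K (x # ys)"
    and n: "\<And>y. y \<in> set (x # ys) \<Longrightarrow> n y \<in> normal_cone K y"
      "n x + (\<Sum>y\<in>set ys. n y) = 0" "n x \<noteq> 0"
  obtains c where "0 < c" "- (sgn (last ys - x) + sgn (hd ys - x)) = c *\<^sub>R n x"
proof -
  have cK: "convex K" "interior K \<noteq> {}" using K by (auto simp: convex_body_def)
  have ys: "ys \<noteq> []" using optimal_polygon_tl_nonempty[OF cK(2) opt] .
  have seg: "x \<notin> closed_segment (last ys) (hd ys)"
    using optimal_polygon_hd_notin_segment[OF cK opt] .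
  then have ne: "last ys \<noteq> x" "hd ys \<noteq> x" by auto
  define w where "w = sgn (last ys - x) + sgn (hd ys - x)"
  have w0: "w \<noteq> 0" using opposite_directions_in_segment[OF ne] seg by (auto simp: w_def)
  have var: "w \<bullet> h \<le> 0" if "0 \<le> n x \<bullet> h" for h
    using optimal_polygon_split[OF opt ys ne, of n "n x" 0 h h] n that
    by (auto simp: w_def inner_add_left zero_in_normal_cone)
  define l where "l = (w \<bullet> n x) / (n x \<bullet> n x)"
  define r where "r = w - l *\<^sub>R n x"
  have "n x \<bullet> r = 0" using n(3) by (simp add: r_def l_def inner_diff_right inner_commute)
  then have "w \<bullet> r \<le> 0" "w \<bullet> r = r \<bullet> r"
    using var[of r] by (auto simp: r_def inner_diff_left)
  then have "r = 0" by (metis inner_eq_zero_iff inner_ge_zero order_antisym)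
  then have w: "w = l *\<^sub>R n x" by (simp add: r_def)
  have "w \<bullet> n x \<le> 0" using var[of "n x"] by simp
  then have "l \<le> 0" by (simp add: l_def divide_nonpos_nonneg)
  moreover have "l \<noteq> 0" using w w0 by auto
  moreover have "- w = (- l) *\<^sub>R n x" using w by simp
  ultimately show thesis using that[of "- l"] by (simp only: w_def)
qed

section \<open>Splitting a bounce at an acute corner\<close>

text \<open>The acute factor is recovered from the linear factor \<open>F\<close>: it is the part of the tangent cone
orthogonal to \<open>F\<close>. Hence it is closed, and it contains every tangent vector orthogonal to \<open>F\<close>.\<close>

lemma acuteness_split:
  fixes K :: "'a::euclidean_space set"
  assumes "acuteness_condition K x"
  obtains F T where "subspace F" "F \<subseteq> tangent_cone K x"
    "T = {t \<in> tangent_cone K x. \<forall>g\<in>F. g \<bullet> t = 0}"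
    "\<forall>z\<in>tangent_cone K x. \<exists>f\<in>F. \<exists>t\<in>T. z = f + t"
    "\<forall>a\<in>T - {0}. \<forall>b\<in>T - {0}. 0 < a \<bullet> b"
proof -
  obtain F T where FT0: "subspace F" "\<forall>f\<in>F. \<forall>t\<in>T. orthogonal f t"
    "tangent_cone K x = {f + t | f t. f \<in> F \<and> t \<in> T}"
    "\<forall>a\<in>T - {0}. \<forall>b\<in>T - {0}. angle_between a b < pi / 2"
    using assms unfolding acuteness_condition_def by (elim exE conjE) (rule that)
  have FT: "subspace F" "\<And>f t. f \<in> F \<Longrightarrow> t \<in> T \<Longrightarrow> f \<bullet> t = 0"
    "tangent_cone K x = {f + t | f t. f \<in> F \<and> t \<in> T}"
    "\<And>a b. a \<in> T - {0} \<Longrightarrow> b \<in> T - {0} \<Longrightarrow> angle_between a b < pi / 2"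
    using FT0 by (simp_all add: orthogonal_def)
  have T: "z \<in> T" if z: "z \<in> tangent_cone K x" "\<forall>g\<in>F. g \<bullet> z = 0" for z
  proof -
    obtain f t where ft: "z = f + t" "f \<in> F" "t \<in> T" using z(1) FT(3) by blast
    then have "f \<bullet> f = 0" using z(2) FT(2) by (force simp: inner_add_right)
    then show ?thesis using ft by simp
  qed
  have "0 \<in> tangent_cone K x" by (simp add: tangent_cone_def polar_cone_def)
  then have "0 \<in> T" using T by simp
  then have sub: "F \<subseteq> tangent_cone K x" using FT(3) by force
  have "T \<subseteq> tangent_cone K x" using FT(3) subspace_0[OF FT(1)] by force
  have pos: "0 < a \<bullet> b" if "a \<in> T - {0}" "b \<in> T - {0}" for a b
  proof (rule ccontr)
    assume "\<not> 0 < a \<bullet> b"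
    then have "(a \<bullet> b) / (norm a * norm b) \<le> 0" by (simp add: divide_nonpos_nonneg)
    moreover have "- 1 \<le> (a \<bullet> b) / (norm a * norm b)"
      using Cauchy_Schwarz_ineq2[of a b] that by (simp add: le_divide_eq abs_le_iff)
    ultimately have "arccos 0 \<le> angle_between a b"
      unfolding angle_between_def by (intro arccos_le_arccos) auto
    then show False using FT(4)[OF that] by simp
  qed
  have "T = {t \<in> tangent_cone K x. \<forall>g\<in>F. g \<bullet> t = 0}"
    using T FT(2) \<open>T \<subseteq> tangent_cone K x\<close> by blast
  moreover have "\<forall>z\<in>tangent_cone K x. \<exists>f\<in>F. \<exists>t\<in>T. z = f + t" using FT(3) by blast
  moreover have "\<forall>a\<in>T - {0}. \<forall>b\<in>T - {0}. 0 < a \<bullet> b" using pos by blast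
  ultimately show thesis by (rule that[OF FT(1) sub])
qed

text \<open>Take for \<open>z\<close> the unit vector of \<open>T\<close> that makes the largest angle with \<open>m\<close>, and for \<open>k\<close> the
smallest value of \<open>z \<bullet> t\<close> over unit vectors \<open>t \<in> T\<close>, which is positive because \<open>T\<close> is acute. The two
polar vectors lie in the plane of \<open>m\<close> and \<open>z\<close>. Their inner product is
\<open>- k * (1 - (m \<bullet> z)\<^sup>2) < 0\<close>, and a positive combination of them is a negative multiple of \<open>m\<close>.\<close>

lemma acute_cone_wide_polar:
  fixes T :: "'a::euclidean_space set"
  assumes closed: "closed T" and cone: "cone T"
    and acute: "\<forall>a\<in>T - {0}. \<forall>b\<in>T - {0}. 0 < a \<bullet> b"
    and m: "m \<in> T" "norm m = 1" and y: "y \<in> T" "norm y = 1" "y \<noteq> m"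
  obtains z k where "z \<in> T" "norm z = 1" "0 < m \<bullet> z" "m \<bullet> z < 1" "0 < k" "k \<le> 1"
    "\<forall>t\<in>T. ((m \<bullet> z) *\<^sub>R z - m) \<bullet> t \<le> 0" "\<forall>t\<in>T. (k *\<^sub>R m - z) \<bullet> t \<le> 0"
proof -
  define S where "S = T \<inter> sphere 0 1"
  have S: "compact S" "S \<noteq> {}" using closed m by (auto simp: S_def closed_Int_compact)
  have unit: "\<exists>s\<in>S. t = norm t *\<^sub>R s" if "t \<in> T" "t \<noteq> 0" for t
    using that mem_cone[OF cone, of t "1 / norm t"] by (intro bexI[of _ "(1 / norm t) *\<^sub>R t"]) (auto simp: S_def)
  have "continuous_on S (\<lambda>s. m \<bullet> s)" by (intro continuous_intros)
  then obtain z where z: "z \<in> S" "\<And>s. s \<in> S \<Longrightarrow> m \<bullet> z \<le> m \<bullet> s"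
    using continuous_attains_inf[OF S, of "\<lambda>s. m \<bullet> s"] by blast
  have "continuous_on S (\<lambda>s. z \<bullet> s)" by (intro continuous_intros)
  then obtain s0 where s0: "s0 \<in> S" "\<And>s. s \<in> S \<Longrightarrow> z \<bullet> s0 \<le> z \<bullet> s"
    using continuous_attains_inf[OF S, of "\<lambda>s. z \<bullet> s"] by blast
  have zT: "z \<in> T" "norm z = 1" using z(1) by (auto simp: S_def)
  have pos: "0 < a \<bullet> b" if "a \<in> S" "b \<in> S" for a b
    using that acute unfolding S_def
    by (metis Diff_iff IntD1 IntD2 mem_sphere_0 norm_zero singletonD zero_neq_one)
  have le1: "a \<bullet> b \<le> 1" if "norm a = 1" "norm b = 1" for a b :: 'a
    using norm_cauchy_schwarz[of a b] that by simp
  have mS: "m \<in> S" using m by (simp add: S_def)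
  have "m \<bullet> y \<noteq> 1"
  proof
    assume "m \<bullet> y = 1"
    then have "(m - y) \<bullet> (m - y) = 0"
      using m(2) y(2) by (simp add: inner_diff_left inner_diff_right inner_commute norm_eq_1)
    then show False using y(3) by simp
  qed
  then have "m \<bullet> y < 1" using le1[OF m(2) y(2)] by simp
  then have lt: "m \<bullet> z < 1" using z(2)[of y] y by (simp add: S_def)
  have d: "0 < m \<bullet> z" using pos[OF mS z(1)] .
  have k: "0 < z \<bullet> s0" "z \<bullet> s0 \<le> 1" using pos[OF z(1) s0(1)] le1[of z s0] zT s0(1) by (auto simp: S_def)
  have P: "((m \<bullet> z) *\<^sub>R z - m) \<bullet> s \<le> 0" "((z \<bullet> s0) *\<^sub>R m - z) \<bullet> s \<le> 0" if "s \<in> S" for s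
  proof -
    have s: "norm s = 1" using that by (simp add: S_def)
    have "(m \<bullet> z) * (z \<bullet> s) \<le> m \<bullet> z" using d le1[OF zT(2) s] by (simp add: mult_left_le)
    then show "((m \<bullet> z) *\<^sub>R z - m) \<bullet> s \<le> 0" using z(2)[OF that] by (simp add: inner_diff_left)
    have "(z \<bullet> s0) * (m \<bullet> s) \<le> z \<bullet> s0" using k(1) le1[OF m(2) s] by (simp add: mult_left_le)
    then show "((z \<bullet> s0) *\<^sub>R m - z) \<bullet> s \<le> 0" using s0(2)[OF that] by (simp add: inner_diff_left)
  qed
  have ext: "v \<bullet> t \<le> 0" if t: "t \<in> T" "\<And>s. s \<in> S \<Longrightarrow> v \<bullet> s \<le> 0" for v t
  proof (cases "t = 0")
    case False
    then obtain s where "s \<in> S" "t = norm t *\<^sub>R s" using unit t(1) by blast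
    then show ?thesis using t(2) by (metis inner_scaleR_right mult_nonneg_nonpos norm_ge_zero)
  qed simp
  show thesis
    using that[OF zT d lt k] ext P by blast
qed

text \<open>With \<open>g = u + a\<close>, the gain for directions \<open>w1\<close> orthogonal to \<open>a\<close> and \<open>w2\<close> orthogonal to \<open>b\<close> is
\<open>g \<bullet> (w1 - w2) - norm (w1 - w2)\<close>. Linear independence of \<open>a\<close> and \<open>b\<close> allows \<open>w1 - w2 = g\<close>, and
then the gain is \<open>norm g * (norm g - 1) > 0\<close>.\<close>

lemma obtuse_splitting_directions:
  fixes a b u v :: "'a::euclidean_space"
  assumes "a + b = - (u + v)" "1 < norm (u + a)" "b \<noteq> 0" "\<And>c. a \<noteq> c *\<^sub>R b"
  obtains w1 w2 where "a \<bullet> w1 = 0" "b \<bullet> w2 = 0" "norm (w1 - w2) < u \<bullet> w1 + v \<bullet> w2"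
proof -
  define g where "g = u + a"
  define r where "r = a - ((a \<bullet> b) / (b \<bullet> b)) *\<^sub>R b"
  have r0: "r \<noteq> 0" using assms(4) by (simp add: r_def)
  have br: "b \<bullet> r = 0" using assms(3) by (simp add: r_def inner_diff_right inner_commute)
  then have ar: "a \<bullet> r = r \<bullet> r" by (simp add: r_def inner_diff_left)
  define w2 where "w2 = - ((a \<bullet> g) / (r \<bullet> r)) *\<^sub>R r"
  define w1 where "w1 = w2 + g"
  have 2: "b \<bullet> w2 = 0" by (simp add: w2_def br)
  have 1: "a \<bullet> w1 = 0" using r0 by (simp add: w1_def w2_def inner_diff_right ar)
  have u: "u = g - a" by (simp add: g_def)
  have "v = (u + v) - u" by simp
  also have "u + v = - (a + b)" using assms(1) by simp
  finally have v: "v = - g - b" by (simp add: g_def algebra_simps)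
  have "u \<bullet> w1 + v \<bullet> w2 = g \<bullet> (w1 - w2)"
    unfolding u v using 1 2 by (simp add: inner_diff_left inner_diff_right)
  also have "\<dots> = norm g * norm g" by (simp add: w1_def power2_norm_eq_inner flip: power2_eq_square)
  also have "\<dots> > norm g * 1" using assms(2) by (intro mult_strict_left_mono) (auto simp: g_def)
  finally show thesis using that[OF 1 2] by (simp add: w1_def)
qed

lemma tangent_cone_diff: "y \<in> K \<Longrightarrow> y - x \<in> tangent_cone K x"
  by (auto simp: tangent_cone_def polar_cone_def normal_cone_def)

lemma tangent_cone_scaleR: "v \<in> tangent_cone K x \<Longrightarrow> 0 \<le> c \<Longrightarrow> c *\<^sub>R v \<in> tangent_cone K x"
  by (simp add: tangent_cone_def polar_cone_def mult_nonneg_nonpos)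

lemma tangent_cone_add:
  "u \<in> tangent_cone K x \<Longrightarrow> v \<in> tangent_cone K x \<Longrightarrow> u + v \<in> tangent_cone K x"
  by (simp add: tangent_cone_def polar_cone_def inner_add_right add_nonpos_nonpos)

lemma closed_tangent_cone: "closed (tangent_cone K x)"
proof -
  have "tangent_cone K x = (\<Inter>n\<in>normal_cone K x. {v. n \<bullet> v \<le> 0})"
    by (auto simp: tangent_cone_def polar_cone_def)
  then show ?thesis by (auto intro!: closed_INT closed_halfspace_le)
qed

lemma normal_coneI_tangent:
  "(\<And>v. v \<in> tangent_cone K x \<Longrightarrow> n \<bullet> v \<le> 0) \<Longrightarrow> n \<in> normal_cone K x"
  using tangent_cone_diff by (auto simp: normal_cone_def)

lemma normal_tangent_le: "n \<in> normal_cone K x \<Longrightarrow> v \<in> tangent_cone K x \<Longrightarrow> n \<bullet> v \<le> 0"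
  by (simp add: tangent_cone_def polar_cone_def)

lemma normal_cone_pointed:
  assumes "interior K \<noteq> {}" "n \<in> normal_cone K x" "- n \<in> normal_cone K x"
  shows "n = 0"
proof (rule ccontr)
  assume "n \<noteq> 0"
  moreover obtain z where "z \<in> interior K" using assms(1) by blast
  ultimately show False
    using normal_cone_interior_less[OF assms(2)] normal_cone_interior_less[OF assms(3)] by fastforce
qed

text \<open>The outer normal \<open>- (u + v)\<close> is a negative multiple of a unit vector \<open>m\<close> in the acute factor \<open>T\<close>.
Since the point is not smooth, \<open>T\<close> is more than a ray, so the obtuse pair of polar vectors
of \<open>T\<close> exists; scaled suitably, it gives normals \<open>a\<close>, \<open>b\<close> with \<open>a + b = - (u + v)\<close>. Then
\<open>norm (u + a)\<^sup>2 + norm (v + a)\<^sup>2 = 2 - 2 * (a \<bullet> b) > 2\<close>, so one of the two norms exceeds \<open>1\<close>. In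
the second case \<open>norm (u + b) = norm (v + a)\<close>, and the two normals are touched in
the opposite order.\<close>

lemma acute_corner_split:
  fixes K :: "'a::euclidean_space set"
  assumes int: "interior K \<noteq> {}" and x: "x \<in> frontier K" and nonsmooth: "\<not> smooth_point K x"
    and acute: "acuteness_condition K x"
    and uv: "u \<in> tangent_cone K x" "v \<in> tangent_cone K x" "norm u = 1" "norm v = 1"
    and nuv: "- (u + v) \<in> normal_cone K x" "u + v \<noteq> 0"
  obtains a b w1 w2 where "a \<in> normal_cone K x" "b \<in> normal_cone K x" "a + b = - (u + v)"
    "a \<bullet> w1 = 0" "b \<bullet> w2 = 0" "norm (w1 - w2) < u \<bullet> w1 + v \<bullet> w2"
proof -
  obtain F T where F: "subspace F" "F \<subseteq> tangent_cone K x"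
    and T_def: "T = {t \<in> tangent_cone K x. \<forall>g\<in>F. g \<bullet> t = 0}"
    and split: "\<forall>z\<in>tangent_cone K x. \<exists>f\<in>F. \<exists>t\<in>T. z = f + t"
    and acuteT: "\<forall>a\<in>T - {0}. \<forall>b\<in>T - {0}. 0 < a \<bullet> b"
    using acuteness_split[OF acute] .
  have "closed T"
  proof -
    have "T = tangent_cone K x \<inter> (\<Inter>g\<in>F. {t. g \<bullet> t = 0})" by (auto simp: T_def)
    then show ?thesis by (auto intro!: closed_Int closed_tangent_cone closed_INT closed_hyperplane)
  qed
  have cone: "cone T" by (auto simp: cone_def T_def tangent_cone_scaleR)
  have normalI: "n \<in> normal_cone K x"
    if "\<And>g. g \<in> F \<Longrightarrow> n \<bullet> g = 0" "\<And>t. t \<in> T \<Longrightarrow> n \<bullet> t \<le> 0" for n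
  proof (rule normal_coneI_tangent)
    fix z assume "z \<in> tangent_cone K x"
    then obtain f t where "z = f + t" "f \<in> F" "t \<in> T" using split by blast
    then show "n \<bullet> z \<le> 0" using that by (simp add: inner_add_right)
  qed
  have normalF: "n \<bullet> g = 0" if "n \<in> normal_cone K x" "g \<in> F" for n g
  proof -
    have "- g \<in> F" using F(1) that(2) by (rule subspace_neg)
    then have "n \<bullet> g \<le> 0" "n \<bullet> (- g) \<le> 0" using normal_tangent_le[OF that(1)] F(2) that(2) by blast+
    then show ?thesis by simp
  qed
  define m where "m = (1 / norm (u + v)) *\<^sub>R (u + v)"
  define s where "s = norm (u + v)"
  have s: "0 < s" "u + v = s *\<^sub>R m" using nuv(2) by (auto simp: s_def m_def)
  have "\<forall>g\<in>F. g \<bullet> (u + v) = 0"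
    using normalF[OF nuv(1)] by (metis inner_commute inner_minus_left neg_equal_0_iff_equal)
  then have "u + v \<in> T" using tangent_cone_add[OF uv(1,2)] by (simp add: T_def)
  then have m: "m \<in> T" "norm m = 1" using mem_cone[OF cone, of "u + v" "1 / norm (u + v)"] nuv(2) by (auto simp: m_def)
  \<comment> \<open>If \<open>T\<close> were the ray of \<open>m\<close>, the normal cone would be the ray of \<open>- m\<close>: the part of a normal
    orthogonal to \<open>m\<close> vanishes on the tangent cone, and the normal cone contains no line.\<close>
  have "\<exists>y. y \<in> T \<and> norm y = 1 \<and> y \<noteq> m"
  proof (rule ccontr)
    assume no: "\<not> ?thesis"
    have ray: "\<exists>c\<ge>0. t = c *\<^sub>R m" if "t \<in> T" for t
    proof (cases "t = 0")
      case False
      then have "(1 / norm t) *\<^sub>R t = m" using no mem_cone[OF cone that, of "1 / norm t"] by auto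
      then have "t = norm t *\<^sub>R m" using False by auto
      then show ?thesis by (metis norm_ge_zero)
    qed (auto intro: exI[of _ 0])
    have mm: "m \<bullet> m = 1" using m(2) by (simp add: norm_eq_1)
    have neg_m: "c *\<^sub>R (- m) \<in> normal_cone K x" if "0 \<le> c" for c
    proof (rule normalI)
      show "(c *\<^sub>R (- m)) \<bullet> g = 0" if "g \<in> F" for g
        using m(1) that by (simp add: T_def inner_commute)
      show "(c *\<^sub>R (- m)) \<bullet> t \<le> 0" if "t \<in> T" for t
        using ray[OF that] \<open>0 \<le> c\<close> mm by auto
    qed
    have "n = (- (n \<bullet> m)) *\<^sub>R (- m)" "n \<bullet> m \<le> 0" if n: "n \<in> normal_cone K x" for n
    proof -
      define r where "r = n - (n \<bullet> m) *\<^sub>R m"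
      have rF: "r \<bullet> g = 0" if "g \<in> F" for g
      proof -
        have "m \<bullet> g = 0" using m(1) that by (simp add: T_def inner_commute)
        then show ?thesis using normalF[OF n that] by (simp add: r_def inner_diff_left)
      qed
      have rT: "r \<bullet> t = 0" if "t \<in> T" for t
        using ray[OF that] mm by (auto simp: r_def inner_diff_left)
      have "r \<in> normal_cone K x" "- r \<in> normal_cone K x" by (rule normalI; simp add: rF rT)+
      then have "r = 0" using normal_cone_pointed[OF int] by blast
      then show "n = (- (n \<bullet> m)) *\<^sub>R (- m)" by (simp add: r_def)
      show "n \<bullet> m \<le> 0" using normal_tangent_le[OF n] m(1) by (simp add: T_def)
    qed
    then have "normal_cone K x = {t *\<^sub>R (- m) | t. 0 \<le> t}"
      using neg_m by (fastforce intro: exI[of _ "- (_ \<bullet> m)"])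
    moreover have "- m \<noteq> 0" using m(2) by auto
    ultimately show False using nonsmooth x unfolding smooth_point_def by blast
  qed
  then obtain y where y: "y \<in> T" "norm y = 1" "y \<noteq> m" by blast
  obtain z k where z: "z \<in> T" "norm z = 1" "0 < m \<bullet> z" "m \<bullet> z < 1" "0 < k" "k \<le> 1"
    "\<forall>t\<in>T. ((m \<bullet> z) *\<^sub>R z - m) \<bullet> t \<le> 0" "\<forall>t\<in>T. (k *\<^sub>R m - z) \<bullet> t \<le> 0"
    using acute_cone_wide_polar[OF \<open>closed T\<close> cone acuteT m y] .
  define d where "d = m \<bullet> z"
  \<comment> \<open>\<open>(d *\<^sub>R z - m) + d *\<^sub>R (k *\<^sub>R m - z) = - (1 - d * k) *\<^sub>R m\<close>, so \<open>l\<close> scales the sum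
    to \<open>- s *\<^sub>R m\<close>.\<close>
  define l where "l = s / (1 - d * k)"
  have "d * k < 1" using z(3-6) mult_le_one[of d k] mult_strict_mono[of d 1 k 1]
    by (metis d_def less_eq_real_def mult.right_neutral mult_left_le order_le_less_trans)
  then have l: "0 < l" "l * (1 - d * k) = s" using s(1) by (auto simp: l_def)
  define a b where "a = l *\<^sub>R (d *\<^sub>R z - m)" and "b = (l * d) *\<^sub>R (k *\<^sub>R m - z)"
  have Fz: "(c *\<^sub>R z + c' *\<^sub>R m) \<bullet> g = 0" if "g \<in> F" for c c' g
  proof -
    have "z \<bullet> g = 0" "m \<bullet> g = 0" using z(1) m(1) that by (simp_all add: T_def inner_commute)
    then show ?thesis by (simp add: inner_add_left)
  qed
  have "d *\<^sub>R z - m \<in> normal_cone K x"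
    using Fz[of _ d "-1"] z(7) by (intro normalI) (auto simp: d_def)
  then have a: "a \<in> normal_cone K x" using l(1) by (simp add: a_def normal_cone_scaleR)
  have "k *\<^sub>R m - z \<in> normal_cone K x"
    using Fz[of _ "-1" k] z(8) by (intro normalI) (auto simp: d_def algebra_simps)
  then have b: "b \<in> normal_cone K x" using l(1) z(3) by (simp add: b_def d_def normal_cone_scaleR)
  have "a + b = - (l * (1 - d * k)) *\<^sub>R m" by (simp add: a_def b_def algebra_simps)
  then have sum: "a + b = - (u + v)" using l(2) s(2) by simp
  then have uvab: "u + v = - (a + b)" by simp
  have "m \<bullet> m = 1" "z \<bullet> z = 1" using m(2) z(2) by (simp_all add: norm_eq_1)
  then have "(d *\<^sub>R z - m) \<bullet> (k *\<^sub>R m - z) = - (k * (1 - d * d))"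
    by (simp add: d_def inner_diff_left inner_diff_right inner_commute algebra_simps)
  then have "a \<bullet> b = - (l * (l * d) * (k * (1 - d * d)))" by (simp add: a_def b_def)
  moreover have "0 < l * (l * d) * (k * (1 - d * d))"
  proof -
    have "d * d < 1" using z(3,4) mult_strict_mono[of d 1 d 1] by (simp add: d_def)
    then show ?thesis using l(1) z(3,5) by (simp add: d_def)
  qed
  ultimately have obtuse: "a \<bullet> b < 0" by simp
  have indep: "p \<noteq> c *\<^sub>R q" if "p \<in> normal_cone K x" "q \<in> normal_cone K x" "p + q = - (u + v)"
    "p \<bullet> q < 0" for p q c
  proof
    assume eq: "p = c *\<^sub>R q"
    then have "c * (q \<bullet> q) < 0" using that(4) by simp
    then have c: "c < 0" "q \<noteq> 0" using inner_ge_zero[of q]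
      by (auto simp: mult_less_0_iff not_less[symmetric])
    then have "(- inverse c) *\<^sub>R p \<in> normal_cone K x" using that(1) by (intro normal_cone_scaleR) auto
    then have "- q \<in> normal_cone K x" using eq c(1) by simp
    then show False using normal_cone_pointed[OF int that(2)] c(2) by blast
  qed
  have eq1: "(norm (u + a))\<^sup>2 + (norm (v + a))\<^sup>2 = 2 - 2 * (a \<bullet> b)"
  proof -
    have "(norm (u + a))\<^sup>2 + (norm (v + a))\<^sup>2 = 2 + 2 * (a \<bullet> (u + v + a))"
      using uv(3,4) unfolding power2_norm_eq_inner norm_eq_1
      by (simp add: inner_add_left inner_add_right inner_commute)
    moreover have "u + v + a = - b" using uvab by simp
    ultimately show ?thesis by simp
  qed
  have "1 < norm (u + a) \<or> 1 < norm (v + a)"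
  proof (rule ccontr)
    assume "\<not> ?thesis"
    then have "(norm (u + a))\<^sup>2 \<le> 1" "(norm (v + a))\<^sup>2 \<le> 1" by (simp_all add: power_le_one)
    then show False using eq1 obtuse by linarith
  qed
  then show thesis
  proof
    assume "1 < norm (u + a)"
    moreover have "b \<noteq> 0" using obtuse by auto
    ultimately show thesis
      using obtuse_splitting_directions[OF sum _ _ indep[OF a b sum obtuse]] that[OF a b sum] by metis
  next
    assume "1 < norm (v + a)"
    moreover have "u + b = - (v + a)"
    proof -
      have "u + b = (u + v) + b - v" by simp
      then show ?thesis unfolding uvab by simp
    qed
    ultimately have "1 < norm (u + b)" by (metis norm_minus_cancel)
    moreover have "a \<noteq> 0" "b + a = - (u + v)" "b \<bullet> a < 0"
      using obtuse sum by (auto simp: add.commute inner_commute)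
    ultimately show thesis
      using obtuse_splitting_directions[of b a u v] indep[OF b a] that[OF b a] by metis
  qed
qed

section \<open>Existence of a classical trajectory\<close>

text \<open>At a non-smooth vertex the normals from \<open>acute_corner_split\<close> are rescaled so that they sum to the
balanced normal of that vertex; splitting the vertex along them would shorten the polygon.\<close>

lemma optimal_polygon_vertex:
  fixes K :: "'a::euclidean_space set"
  assumes K: "convex_body K" "acute_body K"
    and opt: "optimal_polygon K (x # ys)" and sub: "set (x # ys) \<subseteq> K"
  shows "x \<in> frontier K" "x \<notin> closed_segment (last ys) (hd ys)"
    "sgn (x - last ys) - sgn (hd ys - x) \<in> normal_cone K x - {0}" "smooth_point K x"
proof -
  have cK: "convex K" "interior K \<noteq> {}" using K by (auto simp: convex_body_def)
  have ys: "ys \<noteq> []" using optimal_polygon_tl_nonempty[OF cK(2) opt] .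
  show seg: "x \<notin> closed_segment (last ys) (hd ys)"
    using optimal_polygon_hd_notin_segment[OF cK opt] .
  then have ne: "last ys \<noteq> x" "hd ys \<noteq> x" by auto
  obtain n where n: "\<And>y. y \<in> set (x # ys) \<Longrightarrow> n y \<in> normal_cone K y"
    "n x + (\<Sum>y\<in>set ys. n y) = 0" "n x \<noteq> 0"
    using optimal_polygon_normals[OF K(1) opt sub] by blast
  then have nx: "n x \<in> normal_cone K x" by simp
  obtain c where c: "0 < c" "- (sgn (last ys - x) + sgn (hd ys - x)) = c *\<^sub>R n x"
    using optimal_polygon_reflects[OF K(1) opt n] by metis
  define u v where "u = sgn (last ys - x)" and "v = sgn (hd ys - x)"
  have uvc: "- (u + v) = c *\<^sub>R n x" using c(2) by (simp add: u_def v_def)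
  then have uvN: "- (u + v) \<in> normal_cone K x"
    using c(1) nx by (simp only: normal_cone_scaleR less_imp_le)
  have uv0: "u + v \<noteq> 0"
  proof
    assume "u + v = 0"
    then have "c *\<^sub>R n x = 0" using uvc by (metis minus_zero)
    then show False using c(1) n(3) by simp
  qed
  have "sgn (x - last ys) - sgn (hd ys - x) = - (u + v)"
    unfolding u_def v_def by (metis minus_add_distrib minus_diff_eq sgn_minus add_uminus_conv_diff)
  then show "sgn (x - last ys) - sgn (hd ys - x) \<in> normal_cone K x - {0}" using uvN uv0
    by (metis Diff_iff neg_equal_0_iff_equal singletonD)
  have "x \<notin> interior K" using normal_cone_interior_less[OF nx n(3), of x] by auto
  then show x: "x \<in> frontier K" using sub closure_subset by (auto simp: frontier_def)
  show "smooth_point K x"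
  proof (rule ccontr)
    assume ns: "\<not> smooth_point K x"
    have "acuteness_condition K x" using K(2) x ns by (simp add: acute_body_def)
    moreover have "u \<in> tangent_cone K x" "v \<in> tangent_cone K x"
      unfolding u_def v_def sgn_div_norm using sub ys
      by (auto intro!: tangent_cone_scaleR tangent_cone_diff)
    moreover have "norm u = 1" "norm v = 1" using ne by (auto simp: u_def v_def norm_sgn)
    ultimately obtain a b w1 w2 where ab: "a \<in> normal_cone K x" "b \<in> normal_cone K x" "a + b = - (u + v)"
      "a \<bullet> w1 = 0" "b \<bullet> w2 = 0" "norm (w1 - w2) < u \<bullet> w1 + v \<bullet> w2"
      using acute_corner_split[OF cK(2) x ns] uvN uv0 by metis
    have "inverse c *\<^sub>R a + inverse c *\<^sub>R b = n x"
      using ab(3) uvc c(1) by (simp flip: scaleR_add_right)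
    then have "u \<bullet> w1 + v \<bullet> w2 \<le> norm (w1 - w2)"
      using optimal_polygon_split[OF opt ys ne, of n "inverse c *\<^sub>R a" "inverse c *\<^sub>R b" w1 w2]
        n ab c(1) by (simp add: u_def v_def normal_cone_scaleR)
    then show False using ab(6) by simp
  qed
qed

theorem theorem1p1:
  fixes K :: "'a::euclidean_space set"
  assumes "convex_body K"
    and "acute_body K"
  shows "\<exists>m q. m \<le> DIM('a) + 1 \<and> closed_classical_billiard_trajectory K m q"
proof -
  have cK: "convex K" "bounded K" "interior K \<noteq> {}"
    using assms(1) compact_imp_bounded by (auto simp: convex_body_def)
  obtain xs0 where xs0: "optimal_polygon K xs0" "length xs0 \<le> DIM('a) + 1"
    using optimal_polygon_exists[OF cK(1,2)] .
  obtain t where t: "\<forall>x\<in>set xs0. x + t \<in> K" using optimal_polygon_fits[OF assms(1) xs0(1)] .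
  define xs where "xs = map (\<lambda>x. x + t) xs0"
  define m where "m = length xs"
  have opt: "optimal_polygon K xs" "set xs \<subseteq> K" "m \<le> DIM('a) + 1"
    using optimal_polygon_translate[OF xs0(1)] xs0(2) t by (auto simp: xs_def m_def)
  have vertex: "2 \<le> m \<and> xs ! i \<in> frontier K
      \<and> xs ! i \<notin> closed_segment (xs ! ((i + m - 1) mod m)) (xs ! ((i + 1) mod m))
      \<and> sgn (xs ! i - xs ! ((i + m - 1) mod m)) - sgn (xs ! ((i + 1) mod m) - xs ! i)
          \<in> normal_cone K (xs ! i) - {0}
      \<and> smooth_point K (xs ! i)" if i: "i < m" for i
  proof -
    obtain ys where ys: "rotate i xs = xs ! i # ys"
      using rotate_to_front[of i xs] i unfolding m_def by metis
    have o: "optimal_polygon K (xs ! i # ys)" "set (xs ! i # ys) \<subseteq> K"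
      using optimal_polygon_rotate[OF opt(1), of i] opt(2) unfolding ys[symmetric] by auto
    have ne: "ys \<noteq> []" using optimal_polygon_tl_nonempty[OF cK(3) o(1)] .
    have len: "length (rotate i xs) = Suc (length ys)" unfolding ys by simp
    then have m: "m = Suc (length ys)" by (simp add: m_def)
    have "hd ys = rotate i xs ! 1" using ne by (simp add: ys hd_conv_nth)
    also have "\<dots> = xs ! ((i + 1) mod m)"
      using m ne by (subst nth_rotate) (auto simp: m_def)
    finally have h: "hd ys = xs ! ((i + 1) mod m)" .
    have "last ys = rotate i xs ! (m - 1)" using ne m by (simp add: ys last_conv_nth)
    also have "\<dots> = xs ! ((i + m - 1) mod m)"
      using m by (subst nth_rotate) (auto simp: m_def)
    finally have l: "last ys = xs ! ((i + m - 1) mod m)" .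
    have "2 \<le> m" using m ne by (cases ys) auto
    then show ?thesis using optimal_polygon_vertex[OF assms o] unfolding h l by blast
  qed
  have "xs \<noteq> []" using opt(1) untranslatable_nonempty unfolding optimal_polygon_def by fastforce
  then have "0 < m" by (simp add: m_def)
  then have "closed_classical_billiard_trajectory K m ((!) xs)"
    using vertex unfolding closed_classical_billiard_trajectory_def
      closed_generalized_billiard_trajectory_def Let_def by blast
  then show ?thesis using opt(3) by blast
qed

end
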